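(* Let $X,Y$ be Polish spaces, $\mu\in\mathcal P(X)$, $\nu\in\mathcal P(Y)$ Borel probability measures, and $c:X\times Y\to[0,+\infty]$ lower semicontinuous such that, for some $\mathcal K<+\infty$, $\sup_{y}\int_X c(x,y)\,d\mu(x)\le\mathcal K$ and $\sup_{x}\int_Y c(x,y)\,d\nu(y)\le\mathcal K$. Let $\varepsilon>0$ and let $(u_0,v_0)$ be a pair with $\mathcal D_\varepsilon(u_0,v_0)\ge0$, $u_0,v_0\le\mathcal K$, $\int u_0\,d\mu\ge0$, $\int v_0\,d\nu\ge0$ and $v_0=u_0^{c,\varepsilon}$. Define for $n\ge0$ $$u_{n+1}:=v_n^{c,\varepsilon},\qquad v_{n+1}:=u_{n+1}^{c,\varepsilon}.$$ Then the sequence $(u_n,v_n)_n$ converges, uniformly on compact sets, to a maximizer $(\bar u,\bar v)$ of $\mathcal D_\varepsilon$ over $L^1_\mu\times L^1_\nu$ (the maximizer being unique up to replacing $(u,v)$ by $(u+a,v-a)$, $a\in\mathbb R$).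
   Context: For $u\in L^1_\mu$, $v\in L^1_\nu$, $$\mathcal D_\varepsilon(u,v)=\int_X u\,d\mu+\int_Y v\,d\nu-\varepsilon\int_{X\times Y}e^{\frac{u(x)+v(y)-c(x,y)}{\varepsilon}}\,d(\mu\otimes\nu)+\varepsilon\in[-\infty,+\infty),$$ with $e^{-\infty}=0$. The $(c,\varepsilon)$-transforms, defined pointwise everywhere, are $$u^{c,\varepsilon}(y)=-\varepsilon\log\int_X e^{\frac{u(x)-c(x,y)}{\varepsilon}}\,d\mu(x)\quad(y\in Y),\qquad v^{c,\varepsilon}(x)=-\varepsilon\log\int_Y e^{\frac{v(y)-c(x,y)}{\varepsilon}}\,d\nu(y)\quad(x\in X).$$ Here $u_0\in L^1_\mu$ and $v_0\in L^1_\nu$; a pair with the listed properties always exists. *)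

theory Defs
  imports "HOL-Probability.Probability"
begin

definition lower_semicontinuous :: "('a::topological_space \<Rightarrow> 'b::order) \<Rightarrow> bool" where
  "lower_semicontinuous f \<longleftrightarrow> (\<forall>t. open {z. t < f z})"

definition borel_probability :: "'a::topological_space measure \<Rightarrow> bool" where
  "borel_probability M \<longleftrightarrow> sets M = sets borel \<and> prob_space M"

definition exp_ereal :: "ereal \<Rightarrow> ennreal" where
  "exp_ereal t = (case t of ereal r \<Rightarrow> ennreal (exp r) | PInfty \<Rightarrow> \<infinity> | MInfty \<Rightarrow> 0)"

definition ln_ennreal :: "ennreal \<Rightarrow> ereal" where
  "ln_ennreal t = (if t = 0 then -\<infinity> else if t = \<infinity> then \<infinity> else ereal (ln (enn2real t)))"

text \<open>Elements of \<open>L\<^sup>1\<close> are represented by real-valued integrable functions. The integral of the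
  exponential is a nonnegative Lebesgue integral, possibly infinite, so the value lies in
  \<open>[-\<infinity>, \<infinity>)\<close>.\<close>

definition dual_functional ::
    "('a \<times> 'b \<Rightarrow> ennreal) \<Rightarrow> real \<Rightarrow> 'a measure \<Rightarrow> 'b measure \<Rightarrow> ('a \<Rightarrow> real) \<Rightarrow> ('b \<Rightarrow> real) \<Rightarrow> ereal"
  where
  "dual_functional c \<epsilon> \<mu> \<nu> u v =
     ereal ((\<integral>x. u x \<partial>\<mu>) + (\<integral>y. v y \<partial>\<nu>))
     - ereal \<epsilon> * enn2ereal (\<integral>\<^sup>+(x, y). exp_ereal ((ereal (u x + v y) - enn2ereal (c (x, y))) / ereal \<epsilon>)
                                \<partial>(\<mu> \<Otimes>\<^sub>M \<nu>))
     + ereal \<epsilon>"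

definition dual_maximizer ::
    "('a \<times> 'b \<Rightarrow> ennreal) \<Rightarrow> real \<Rightarrow> 'a measure \<Rightarrow> 'b measure \<Rightarrow> ('a \<Rightarrow> real) \<Rightarrow> ('b \<Rightarrow> real) \<Rightarrow> bool"
  where
  "dual_maximizer c \<epsilon> \<mu> \<nu> u v \<longleftrightarrow>
     is_arg_max (\<lambda>(u, v). dual_functional c \<epsilon> \<mu> \<nu> u v)
       (\<lambda>(u, v). integrable \<mu> u \<and> integrable \<nu> v) (u, v)"

text \<open>The \<open>(c, \<epsilon>)\<close>-transforms of a function on the first and on the second factor. They are
  extended-real-valued because the integral could a priori be \<open>0\<close> or \<open>\<infinity>\<close>.\<close>

definition transform_fst ::
    "('a \<times> 'b \<Rightarrow> ennreal) \<Rightarrow> real \<Rightarrow> 'a measure \<Rightarrow> ('a \<Rightarrow> real) \<Rightarrow> 'b \<Rightarrow> ereal" where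
  "transform_fst c \<epsilon> \<mu> u y =
     - ereal \<epsilon> * ln_ennreal (\<integral>\<^sup>+x. exp_ereal ((ereal (u x) - enn2ereal (c (x, y))) / ereal \<epsilon>) \<partial>\<mu>)"

definition transform_snd ::
    "('a \<times> 'b \<Rightarrow> ennreal) \<Rightarrow> real \<Rightarrow> 'b measure \<Rightarrow> ('b \<Rightarrow> real) \<Rightarrow> 'a \<Rightarrow> ereal" where
  "transform_snd c \<epsilon> \<nu> v x =
     - ereal \<epsilon> * ln_ennreal (\<integral>\<^sup>+y. exp_ereal ((ereal (v y) - enn2ereal (c (x, y))) / ereal \<epsilon>) \<partial>\<nu>)"

end

(* Write k = exp (-c / eps). Jensen's inequality keeps all iterates in [-K, K] as long as the means
   stay nonnegative, and the means increase because exp ((u_n - u_{n+1}) / eps) has integral 1.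
   The ratio exp ((v_n - v_{n+1}) / eps) at y is the average of exp ((u_{n+1} - u_n) / eps) against
   the probability density exp ((u_n + v_n y) / eps) k(., y). Any two of these densities, for y and y',
   share the mass of exp (-2K / eps) k(., y) k(., y'), which is at least exp (-4K / eps), so each
   half-step contracts the multiplicative oscillation (Doeblin). Together with the normalization
   of the ratios, the increments decay geometrically in the sup norm, and the limit is a fixed point.
   For a fixed point the density exp ((u + v - c) / eps) has marginals mu and nu, and the inequality
   1 + t <= exp t, strict for t nonzero, integrated against it gives optimality and uniqueness. *)

theory Submission
  imports Defs
begin

section \<open>The Gibbs kernel and Jensen's inequality\<close>

definition gibbs :: "real \<Rightarrow> ennreal \<Rightarrow> real" where
  "gibbs e t = (if t = \<infinity> then 0 else exp (- enn2real t / e))"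

lemma gibbs_nonneg [simp]: "0 \<le> gibbs e t"
  by (simp add: gibbs_def)

lemma gibbs_le_one [simp]: "0 < e \<Longrightarrow> gibbs e t \<le> 1"
  by (simp add: gibbs_def)

lemma gibbs_pos: "t \<noteq> \<infinity> \<Longrightarrow> 0 < gibbs e t"
  by (simp add: gibbs_def)

lemma gibbs_add: "gibbs e (s + t) = gibbs e s * gibbs e t"
  by (cases s; cases t)
    (auto simp: gibbs_def enn2real_plus exp_add[symmetric] add_divide_distrib diff_divide_distrib less_top)

lemma gibbs_measurable [measurable]: "gibbs e \<in> borel_measurable borel"
  unfolding gibbs_def by measurable

text \<open>Passes from extended-real exponentials to real ones, so that Bochner integrals apply.
  The explicit value 0 of \<open>gibbs\<close> at infinity matches \<open>exp_ereal\<close> at minus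
  infinity; \<open>enn2real\<close> alone would send an infinite cost to the factor 1.\<close>

lemma exp_ereal_gibbs:
  assumes "0 < e"
  shows "exp_ereal ((ereal a - enn2ereal t) / ereal e) = ennreal (exp (a / e) * gibbs e t)"
proof (cases t)
  case (real r)
  then show ?thesis using assms
    by (simp add: exp_ereal_def gibbs_def enn2ereal_ennreal exp_add[symmetric] diff_divide_distrib)
next
  case top
  then show ?thesis using assms
    by (simp add: exp_ereal_def gibbs_def)
qed

text \<open>Jensen's inequality for \<open>exp\<close> and \<open>(h - d) / e\<close>; the bound on
  the integral makes \<open>d\<close> finite almost everywhere. The cost is a general
  \<open>d\<close> because both a single section of the cost and a sum of two sections are inserted
  later.\<close>

lemma (in prob_space) exp_mean_le_integral:
  assumes h: "integrable M h" and d [measurable]: "d \<in> borel_measurable M"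
    and dK: "(\<integral>\<^sup>+x. d x \<partial>M) \<le> ennreal K" and "0 \<le> K" "0 < e"
    and int: "integrable M (\<lambda>x. exp (h x / e) * gibbs e (d x))"
  shows "exp (((\<integral>x. h x \<partial>M) - K) / e) \<le> (\<integral>x. exp (h x / e) * gibbs e (d x) \<partial>M)"
proof -
  have "(\<integral>\<^sup>+x. d x \<partial>M) < \<infinity>"
    using dK by (simp add: le_less_trans)
  then have fin: "AE x in M. d x \<noteq> \<infinity>"
    by (intro nn_integral_PInf_AE) auto
  have nn: "(\<integral>\<^sup>+x. ennreal (enn2real (d x)) \<partial>M) = (\<integral>\<^sup>+x. d x \<partial>M)"
    using fin by (intro nn_integral_cong_AE) (auto simp: less_top)
  have id: "integrable M (\<lambda>x. enn2real (d x))"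
    using \<open>_ < \<infinity>\<close> nn by (intro integrableI_bounded) auto
  have "ennreal (\<integral>x. enn2real (d x) \<partial>M) = (\<integral>\<^sup>+x. d x \<partial>M)"
    using nn_integral_eq_integral[OF id] nn by simp
  with dK have le: "(\<integral>x. enn2real (d x) \<partial>M) \<le> K"
    using \<open>0 \<le> K\<close> by (metis ennreal_le_iff)
  define g where "g x = (h x - enn2real (d x)) / e" for x
  have ig: "integrable M g"
    unfolding g_def using h id by simp
  have [measurable]: "h \<in> borel_measurable M" using h by simp
  have eq: "AE x in M. exp (h x / e) * gibbs e (d x) = exp (g x)"
    using fin by eventually_elim
      (simp add: gibbs_def g_def exp_add[symmetric] diff_divide_distrib)
  have ie: "integrable M (\<lambda>x. exp (g x))"
    using int eq ig by (subst (asm) integrable_cong_AE) auto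
  have "exp (((\<integral>x. h x \<partial>M) - K) / e) \<le> exp (\<integral>x. g x \<partial>M)"
    unfolding g_def using h id le \<open>0 < e\<close> by (simp add: divide_right_mono)
  also have "\<dots> \<le> (\<integral>x. exp (g x) \<partial>M)"
    by (rule jensens_inequality[of g UNIV]) (use ig ie exp_convex in auto)
  also have "\<dots> = (\<integral>x. exp (h x / e) * gibbs e (d x) \<partial>M)"
    using eq int ig by (intro integral_cong_AE) (auto elim: eventually_mono)
  finally show ?thesis .
qed

section \<open>The real-valued transform and its a priori bounds\<close>

definition soft_transform :: "real \<Rightarrow> 'a measure \<Rightarrow> ('a \<Rightarrow> 'b \<Rightarrow> ennreal) \<Rightarrow> ('a \<Rightarrow> real) \<Rightarrow> 'b \<Rightarrow> real"
  where "soft_transform e M c u y = - e * ln (\<integral>x. exp (u x / e) * gibbs e (c x y) \<partial>M)"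

text \<open>The class preserved by the iteration. It has no lower bound and only an
  almost-everywhere upper bound, which is all that is known of the starting pair.\<close>

definition admissible :: "real \<Rightarrow> 'a measure \<Rightarrow> ('a \<Rightarrow> real) \<Rightarrow> bool" where
  "admissible K M u \<longleftrightarrow> integrable M u \<and> (AE x in M. u x \<le> K) \<and> 0 \<le> (\<integral>x. u x \<partial>M)"

text \<open>Ratios of values of \<open>exp (w / e)\<close> exceed 1 by at most \<open>d\<close>. It
  is this excess \<open>d\<close>, not its logarithm, that one application of the transform
  multiplies by a fixed factor.\<close>

definition osc_le :: "real \<Rightarrow> real \<Rightarrow> ('a \<Rightarrow> real) \<Rightarrow> bool" where
  "osc_le e d w \<longleftrightarrow> (\<forall>x x'. exp ((w x - w x') / e) \<le> 1 + d)"

text \<open>The cost bounds hold for every section, so the transforms are controlled at every point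
  and not merely almost everywhere.\<close>

locale bounded_cost = pair_prob_space M N
  for M :: "'a measure" and N :: "'b measure" +
  fixes c :: "'a \<Rightarrow> 'b \<Rightarrow> ennreal" and e K :: real
  assumes space_M [simp]: "space M = UNIV" and space_N [simp]: "space N = UNIV"
    and c_meas: "case_prod c \<in> borel_measurable (M \<Otimes>\<^sub>M N)"
    and e_pos: "0 < e" and K_nonneg: "0 \<le> K"
    and cost_fst: "\<And>y. (\<integral>\<^sup>+x. c x y \<partial>M) \<le> ennreal K"
    and cost_snd: "\<And>x. (\<integral>\<^sup>+y. c x y \<partial>N) \<le> ennreal K"
begin

lemma total_mass [simp]:
  "measure M UNIV = 1" "measure N UNIV = 1" "emeasure M UNIV = 1" "emeasure N UNIV = 1"
  using M1.prob_space M2.prob_space M1.emeasure_space_1 M2.emeasure_space_1 by simp_all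

text \<open>The setting is symmetric in the two factors, so each fact about
  \<open>soft_transform\<close> also covers the other transform, which is the same operator with the
  arguments of \<open>c\<close> exchanged.\<close>

lemma swapped: "bounded_cost N M (\<lambda>y x. c x y) e K"
proof -
  interpret S: pair_prob_space N M ..
  have "(\<lambda>(y, x). c x y) \<in> borel_measurable (N \<Otimes>\<^sub>M M)"
    using measurable_pair_swap[OF c_meas] by (simp add: case_prod_unfold)
  then show ?thesis
    by unfold_locales (use e_pos K_nonneg cost_fst cost_snd in auto)
qed

lemma c_measurable [measurable (raw)]:
  "f \<in> measurable L M \<Longrightarrow> g \<in> measurable L N \<Longrightarrow> (\<lambda>z. c (f z) (g z)) \<in> borel_measurable L"
  using measurable_compose[OF measurable_Pair c_meas, of f L g] by simp

lemma const_measurable [simp]: "(\<lambda>_. x) \<in> measurable L M" "(\<lambda>_. y) \<in> measurable L N"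
  by (simp_all add: measurable_const)

lemma c_fst_measurable [measurable]: "(\<lambda>x. c x y) \<in> borel_measurable M"
  by (rule c_measurable) auto

lemma integrable_exp_gibbs:
  assumes "admissible K M u"
  shows "integrable M (\<lambda>x. exp (u x / e) * gibbs e (c x y))"
proof (rule M1.integrable_const_bound[where B = "exp (K / e)"])
  have [measurable]: "u \<in> borel_measurable M" and "AE x in M. u x \<le> K"
    using assms by (auto simp: admissible_def)
  from this(2) show "AE x in M. norm (exp (u x / e) * gibbs e (c x y)) \<le> exp (K / e)"
  proof eventually_elim
    case (elim x)
    then have "exp (u x / e) * gibbs e (c x y) \<le> exp (K / e) * 1"
      using e_pos by (intro mult_mono) (auto simp: divide_right_mono)
    then show ?case by (simp add: abs_mult)
  qed
  show "(\<lambda>x. exp (u x / e) * gibbs e (c x y)) \<in> borel_measurable M" by measurable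
qed

text \<open>The lower bound is Jensen's inequality combined with the nonnegative mean of
  \<open>u\<close>; the upper bound only uses \<open>u\<close> at most \<open>K\<close> and a kernel
  at most 1.\<close>

lemma exp_transform_bounds:
  assumes "admissible K M u"
  shows "exp (- K / e) \<le> (\<integral>x. exp (u x / e) * gibbs e (c x y) \<partial>M)" (is "_ \<le> ?I")
    and "(\<integral>x. exp (u x / e) * gibbs e (c x y) \<partial>M) \<le> exp (K / e)"
proof -
  note int = integrable_exp_gibbs[OF assms, of y]
  have "exp (- K / e) \<le> exp (((\<integral>x. u x \<partial>M) - K) / e)"
    using assms e_pos unfolding exp_le_cancel_iff admissible_def by (intro divide_right_mono) auto
  also have "\<dots> \<le> ?I"
    by (rule M1.exp_mean_le_integral)
      (use assms int cost_fst K_nonneg e_pos in \<open>auto simp: admissible_def\<close>)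
  finally show "exp (- K / e) \<le> ?I" .
  have "?I \<le> (\<integral>x. exp (K / e) \<partial>M)"
  proof (rule integral_mono_AE[OF int])
    have "AE x in M. u x \<le> K" using assms by (simp add: admissible_def)
    then show "AE x in M. exp (u x / e) * gibbs e (c x y) \<le> exp (K / e)"
    proof eventually_elim
      case (elim x)
      then have "exp (u x / e) * gibbs e (c x y) \<le> exp (K / e) * 1"
        using e_pos by (intro mult_mono) (auto simp: divide_right_mono)
      then show ?case by simp
    qed
  qed simp
  then show "?I \<le> exp (K / e)" by simp
qed

text \<open>The logarithm can be undone because the integral is positive. All later arguments use
  this multiplicative form.\<close>

lemma exp_transform:
  assumes "admissible K M u"
  shows "exp (- soft_transform e M c u y / e) = (\<integral>x. exp (u x / e) * gibbs e (c x y) \<partial>M)"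
  using exp_transform_bounds(1)[OF assms, of y] e_pos
  by (simp add: soft_transform_def less_le_trans[OF exp_gt_zero])

lemma transform_bounded:
  assumes "admissible K M u"
  shows "\<bar>soft_transform e M c u y\<bar> \<le> K"
proof -
  have "exp (- K / e) \<le> exp (- soft_transform e M c u y / e)"
    "exp (- soft_transform e M c u y / e) \<le> exp (K / e)"
    unfolding exp_transform[OF assms] by (rule exp_transform_bounds[OF assms])+
  then have "- K / e \<le> - soft_transform e M c u y / e" "- soft_transform e M c u y / e \<le> K / e"
    by (simp_all only: exp_le_cancel_iff)
  then show ?thesis using e_pos unfolding divide_le_cancel by auto
qed

lemma transform_measurable:
  assumes [measurable]: "u \<in> borel_measurable M"
  shows "soft_transform e M c u \<in> borel_measurable N"
  unfolding soft_transform_def[abs_def] by measurable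

lemma transform_fst_eq:
  assumes "admissible K M u"
  shows "transform_fst (case_prod c) e M u y = ereal (soft_transform e M c u y)"
proof -
  have "(\<integral>\<^sup>+x. exp_ereal ((ereal (u x) - enn2ereal (c x y)) / ereal e) \<partial>M)
      = ennreal (\<integral>x. exp (u x / e) * gibbs e (c x y) \<partial>M)"
    using integrable_exp_gibbs[OF assms] e_pos
    by (simp add: exp_ereal_gibbs nn_integral_eq_integral)
  moreover have "0 < (\<integral>x. exp (u x / e) * gibbs e (c x y) \<partial>M)"
    using exp_transform_bounds(1)[OF assms, of y] by (simp add: less_le_trans[OF exp_gt_zero])
  ultimately show ?thesis
    by (simp add: transform_fst_def ln_ennreal_def soft_transform_def)
qed

text \<open>Tonelli's theorem for the kernel, stated with nonnegative integrals so that
  integrability of the product need not be known beforehand.\<close>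

lemma integral_fst_snd_swap:
  assumes [measurable]: "f \<in> borel_measurable M" "g \<in> borel_measurable N"
  shows "(\<integral>\<^sup>+x. ennreal (exp (f x)) * (\<integral>\<^sup>+y. ennreal (exp (g y) * gibbs e (c x y)) \<partial>N) \<partial>M)
    = (\<integral>\<^sup>+y. ennreal (exp (g y)) * (\<integral>\<^sup>+x. ennreal (exp (f x) * gibbs e (c x y)) \<partial>M) \<partial>N)"
proof -
  have "(\<integral>\<^sup>+x. ennreal (exp (f x)) * (\<integral>\<^sup>+y. ennreal (exp (g y) * gibbs e (c x y)) \<partial>N) \<partial>M)
    = (\<integral>\<^sup>+x. (\<integral>\<^sup>+y. ennreal (exp (f x) * (exp (g y) * gibbs e (c x y))) \<partial>N) \<partial>M)"
    by (simp add: nn_integral_cmult[symmetric] ennreal_mult[symmetric])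
  also have "\<dots> = (\<integral>\<^sup>+y. (\<integral>\<^sup>+x. ennreal (exp (f x) * (exp (g y) * gibbs e (c x y))) \<partial>M) \<partial>N)"
    by (rule Fubini'[symmetric]) measurable
  also have "\<dots> = (\<integral>\<^sup>+y. ennreal (exp (g y)) * (\<integral>\<^sup>+x. ennreal (exp (f x) * gibbs e (c x y)) \<partial>M) \<partial>N)"
    by (simp add: nn_integral_cmult[symmetric] ennreal_mult[symmetric] ac_simps)
  finally show ?thesis .
qed

text \<open>Here \<open>exp (- u' x / e)\<close> is an integral over \<open>N\<close>. After
  exchanging the integrals, the inner one over \<open>M\<close> is \<open>exp (- v y / e)\<close>,
  which cancels the remaining factor and leaves the total mass of \<open>N\<close>.\<close>

lemma mass_one:
  assumes u: "admissible K M u" and v: "admissible K N v" and vu: "v = soft_transform e M c u"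
    and u': "u' = soft_transform e N (\<lambda>y x. c x y) v"
  shows "integrable M (\<lambda>x. exp ((u x - u' x) / e))" and "(\<integral>x. exp ((u x - u' x) / e) \<partial>M) = 1"
proof -
  interpret S: bounded_cost N M "\<lambda>y x. c x y" e K by (rule swapped)
  have [measurable]: "u \<in> borel_measurable M" "v \<in> borel_measurable N"
    using u v by (auto simp: admissible_def)
  have [measurable]: "u' \<in> borel_measurable M"
    unfolding u' by (rule S.transform_measurable) measurable
  have "(\<integral>\<^sup>+x. ennreal (exp ((u x - u' x) / e)) \<partial>M)
      = (\<integral>\<^sup>+x. ennreal (exp (u x / e)) * (\<integral>\<^sup>+y. ennreal (exp (v y / e) * gibbs e (c x y)) \<partial>N) \<partial>M)"
    using S.integrable_exp_gibbs[OF v]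
    by (simp add: nn_integral_eq_integral S.exp_transform[OF v, symmetric] u'[symmetric]
        ennreal_mult[symmetric] exp_add[symmetric] diff_divide_distrib)
  also have "\<dots> = (\<integral>\<^sup>+y. ennreal (exp (v y / e)) * (\<integral>\<^sup>+x. ennreal (exp (u x / e) * gibbs e (c x y)) \<partial>M) \<partial>N)"
    by (rule integral_fst_snd_swap) measurable
  also have "\<dots> = (\<integral>\<^sup>+y. 1 \<partial>N)"
    using integrable_exp_gibbs[OF u]
    by (simp add: nn_integral_eq_integral exp_transform[OF u, symmetric] vu[symmetric]
        ennreal_mult[symmetric] exp_add[symmetric])
  finally have nn: "(\<integral>\<^sup>+x. ennreal (exp ((u x - u' x) / e)) \<partial>M) = 1"
    by simp
  show int: "integrable M (\<lambda>x. exp ((u x - u' x) / e))"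
    by (rule integrableI_bounded) (use nn in auto)
  show "(\<integral>x. exp ((u x - u' x) / e) \<partial>M) = 1"
    using nn by (subst integral_eq_nn_integral) auto
qed

text \<open>Integrating \<open>1 + t <= exp t\<close> with \<open>t = (u - u') / e\<close> against
  \<open>mass_one\<close> shows that the mean does not decrease; the upper bound on
  \<open>u'\<close> comes from its being a transform.\<close>

lemma admissible_step:
  assumes u: "admissible K M u" and v: "admissible K N v" and vu: "v = soft_transform e M c u"
    and u': "u' = soft_transform e N (\<lambda>y x. c x y) v"
  shows "admissible K M u'"
proof -
  interpret S: bounded_cost N M "\<lambda>y x. c x y" e K by (rule swapped)
  have [measurable]: "v \<in> borel_measurable N" and iu: "integrable M u"
    using u v by (auto simp: admissible_def)
  have [measurable]: "u' \<in> borel_measurable M"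
    unfolding u' by (rule S.transform_measurable) measurable
  have b: "\<bar>u' x\<bar> \<le> K" for x
    unfolding u' by (rule S.transform_bounded[OF v])
  have iu': "integrable M u'"
    by (rule M1.integrable_const_bound[where B = K]) (use b in auto)
  have "(\<integral>x. 1 + (u x - u' x) / e \<partial>M) \<le> (\<integral>x. exp ((u x - u' x) / e) \<partial>M)"
    by (rule integral_mono) (use iu iu' mass_one(1)[OF assms] exp_ge_add_one_self in auto)
  also have "\<dots> = 1" by (rule mass_one(2)[OF assms])
  finally have "((\<integral>x. u x \<partial>M) - (\<integral>x. u' x \<partial>M)) / e \<le> 0"
    using iu iu' by simp
  then have "(\<integral>x. u x \<partial>M) \<le> (\<integral>x. u' x \<partial>M)"
    using e_pos by (simp add: divide_le_0_iff)
  then show ?thesis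
    using u iu' b by (auto simp: admissible_def abs_le_iff)
qed

end

section \<open>From oscillation bounds to uniform convergence\<close>

lemma osc_le_mono: "osc_le e d w \<Longrightarrow> d \<le> d' \<Longrightarrow> osc_le e d' w"
  unfolding osc_le_def by (meson add_left_mono order_trans)

text \<open>Oscillation does not see additive constants; the normalization fixes the constant.
  Comparing the value at \<open>x\<close> with the average 1 gives both \<open>exp (w x / e)\<close>
  and \<open>exp (- w x / e)\<close> at most \<open>1 + d\<close>, hence at most
  \<open>exp d\<close>.\<close>

lemma (in prob_space) osc_le_imp_abs_le:
  assumes osc: "osc_le e d w" and sp: "space M = UNIV" and "0 < e" "0 \<le> d"
    and int: "integrable M (\<lambda>x. exp (- w x / e))" and one: "(\<integral>x. exp (- w x / e) \<partial>M) = 1"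
  shows "\<bar>w x\<bar> \<le> e * d"
proof -
  have osc': "exp ((w x - w x') / e) \<le> 1 + d" for x x'
    using osc by (simp add: osc_le_def)
  have "exp (w x / e) * (\<integral>x'. exp (- w x' / e) \<partial>M) = (\<integral>x'. exp ((w x - w x') / e) \<partial>M)"
    by (simp add: diff_divide_distrib exp_add[symmetric] flip: integral_mult_right_zero)
  also have "\<dots> \<le> (\<integral>x'. 1 + d \<partial>M)"
  proof (rule integral_mono)
    show "integrable M (\<lambda>x'. exp ((w x - w x') / e))"
      using integrable_mult_right[OF int, of "exp (w x / e)"]
      by (simp add: diff_divide_distrib exp_add[symmetric])
  qed (use osc' in auto)
  finally have "exp (w x / e) \<le> 1 + d" using one by (simp add: prob_space)
  also have "\<dots> \<le> exp d" by (rule exp_ge_add_one_self)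
  finally have upper: "w x \<le> e * d" using \<open>0 < e\<close> by (simp add: field_simps)
  have "exp (- w x / e) = (\<integral>x'. exp (- w x / e) \<partial>M)" by (simp add: prob_space)
  also have "\<dots> \<le> (\<integral>x'. (1 + d) * exp (- w x' / e) \<partial>M)"
  proof (rule integral_mono)
    fix x'
    have "exp (- w x / e) = exp ((w x' - w x) / e) * exp (- w x' / e)"
      by (simp add: exp_add[symmetric] diff_divide_distrib)
    also have "\<dots> \<le> (1 + d) * exp (- w x' / e)"
      by (rule mult_right_mono[OF osc']) simp
    finally show "exp (- w x / e) \<le> (1 + d) * exp (- w x' / e)" .
  qed (use int in auto)
  also have "\<dots> = 1 + d" using one by simp
  also have "\<dots> \<le> exp d" by (rule exp_ge_add_one_self)
  finally have "- w x \<le> e * d" using \<open>0 < e\<close> by (simp add: field_simps)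
  with upper show ?thesis by (simp add: abs_le_iff)
qed

text \<open>The Weierstrass M-test applied to the telescoping sum of increments.\<close>

lemma uniformly_convergent_of_geometric_increments:
  fixes f :: "nat \<Rightarrow> 'a \<Rightarrow> real"
  assumes "\<And>n x. \<bar>f (Suc n) x - f n x\<bar> \<le> C * r ^ n" and "0 \<le> r" "r < 1"
  shows "\<exists>g. uniform_limit UNIV f g sequentially"
proof -
  have "uniformly_convergent_on UNIV (\<lambda>n x. \<Sum>i<n. f (Suc i) x - f i x)"
    by (rule Weierstrass_m_test'[where M = "\<lambda>n. C * r ^ n"])
      (use assms in \<open>auto intro!: summable_mult summable_geometric\<close>)
  then obtain l where "uniform_limit UNIV (\<lambda>n x. \<Sum>i<n. f (Suc i) x - f i x) l sequentially"
    by (auto simp: uniformly_convergent_on_def)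
  then have "uniform_limit UNIV (\<lambda>n x. f 0 x + (\<Sum>i<n. f (Suc i) x - f i x))
      (\<lambda>x. f 0 x + l x) sequentially"
    by (intro uniform_limit_intros)
  moreover have "f 0 x + (\<Sum>i<n. f (Suc i) x - f i x) = f n x" for n x
    using sum_lessThan_telescope[of "\<lambda>i. f i x" n] by simp
  ultimately show ?thesis by auto
qed

text \<open>Allows the geometric estimates to start at index 1, since the starting function
  \<open>u 0\<close> may be unbounded.\<close>

lemma uniform_limit_sequentially_Suc:
  "uniform_limit S (\<lambda>n. f (Suc n)) g sequentially \<longleftrightarrow> uniform_limit S f g sequentially"
  unfolding uniform_limit_iff
  using eventually_sequentially_Suc[of "\<lambda>n. \<forall>x\<in>S. dist (f n x) (g x) < _"] by simp

section \<open>The Doeblin contraction\<close>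

context bounded_cost
begin

text \<open>One factor \<open>exp (- 2 * K / e)\<close> comes from the lower bound on the
  exponential weight of a density, the other from \<open>overlap_lower_bound\<close>.\<close>

definition contraction_rate :: real where "contraction_rate = 1 - exp (- 4 * K / e)"

lemma contraction_rate: "0 \<le> contraction_rate" "contraction_rate < 1"
  using K_nonneg e_pos by (simp_all add: contraction_rate_def)

text \<open>The product of the kernels is the kernel of the summed cost, whose integral is at most
  \<open>2 * K\<close>, so Jensen's inequality applies.\<close>

lemma overlap_lower_bound:
  "exp (- 2 * K / e) \<le> (\<integral>x. gibbs e (c x y) * gibbs e (c x y') \<partial>M)"
proof -
  have "(\<integral>\<^sup>+x. c x y + c x y' \<partial>M) = (\<integral>\<^sup>+x. c x y \<partial>M) + (\<integral>\<^sup>+x. c x y' \<partial>M)"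
    by (rule nn_integral_add) auto
  also have "\<dots> \<le> ennreal K + ennreal K" by (intro add_mono cost_fst)
  finally have le: "(\<integral>\<^sup>+x. c x y + c x y' \<partial>M) \<le> ennreal (2 * K)"
    using K_nonneg by (simp add: ennreal_plus[symmetric] del: ennreal_plus)
  \<comment> \<open>The trivial factor \<open>exp (0 / e)\<close> puts the integrand in the form
    required by \<open>exp_mean_le_integral\<close> with \<open>h = 0\<close>.\<close>
  have int: "integrable M (\<lambda>x. exp (0 / e) * gibbs e (c x y + c x y'))"
    by (rule M1.integrable_const_bound[where B = 1]) (use e_pos in auto)
  show ?thesis
    using M1.exp_mean_le_integral[OF _ _ le _ e_pos int] K_nonneg by (simp add: gibbs_add)
qed

text \<open>The pointwise two-sided bound on \<open>u\<close>, which \<open>admissible\<close> does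
  not provide, yields a minorant of the densities valid at every point.\<close>

lemma transform_contracts:
  assumes u: "admissible K M u" "\<And>x. \<bar>u x\<bar> \<le> K" and u': "admissible K M u'" "\<And>x. \<bar>u' x\<bar> \<le> K"
    and osc: "osc_le e d (\<lambda>x. u' x - u x)" and "0 \<le> d"
  shows "osc_le e (contraction_rate * d) (\<lambda>y. soft_transform e M c u' y - soft_transform e M c u y)"
  unfolding osc_le_def
proof (intro allI)
  \<comment> \<open>The first point is named \<open>y'\<close>: the transform reverses signs, so the
    ratio to be bounded is the average of \<open>F\<close> at \<open>y\<close> over the average at
    \<open>y'\<close>.\<close>
  fix y' y
  define T where "T = soft_transform e M c u"
  define T' where "T' = soft_transform e M c u'"
  \<comment> \<open>\<open>p z\<close> are probability densities, \<open>m\<close> is a common minorant of \<open>p y\<close> and \<open>p y'\<close>; splitting \<open>p = m + (p - m)\<close>,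
     only the second part sees the oscillation of \<open>F\<close>.\<close>
  define F where "F x = exp ((u' x - u x) / e)" for x
  define p where "p z x = exp ((u x + T z) / e) * gibbs e (c x z)" for z x
  define m where "m x = exp (- 2 * K / e) * (gibbs e (c x y) * gibbs e (c x y'))" for x
  define A where "A = (INF x. F x)"
  define B where "B = (\<integral>x. F x * m x \<partial>M)"
  define L where "L = (\<integral>x. m x \<partial>M)"
  have [measurable]: "u \<in> borel_measurable M" "u' \<in> borel_measurable M"
    using u u' by (auto simp: admissible_def)
  have Fpos: "0 < F x" for x by (simp add: F_def)
  have Fosc: "F x \<le> (1 + d) * F x'" for x x'
  proof -
    have "F x = exp (((u' x - u x) - (u' x' - u x')) / e) * F x'"
      by (simp add: F_def exp_add[symmetric] diff_divide_distrib)
    also have "\<dots> \<le> (1 + d) * F x'"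
      using osc Fpos[of x'] by (intro mult_right_mono) (auto simp: osc_le_def)
    finally show ?thesis .
  qed
  have bdd: "bdd_below (range F)" using Fpos by (auto intro!: bdd_belowI[of _ 0] less_imp_le)
  have AF: "A \<le> F x" for x unfolding A_def by (rule cINF_lower[OF bdd]) simp
  \<comment> \<open>Together with \<open>AF\<close> this confines \<open>F\<close> to the interval
    from \<open>A\<close> to \<open>(1 + d) * A\<close>.\<close>
  have FA: "F x \<le> (1 + d) * A" for x
  proof -
    have "F x / (1 + d) \<le> A" unfolding A_def
      by (rule cINF_greatest) (use Fosc \<open>0 \<le> d\<close> in \<open>auto simp: field_simps\<close>)
    then show ?thesis using \<open>0 \<le> d\<close> by (simp add: field_simps)
  qed
  have Apos: "0 < A"
    using FA[of undefined] Fpos[of undefined] \<open>0 \<le> d\<close>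
    by (metis add_nonneg_pos less_le_trans linorder_not_less mult_nonneg_nonpos zero_less_one
        add.commute less_imp_le)
  have Tb: "\<bar>T z\<bar> \<le> K" for z unfolding T_def by (rule transform_bounded[OF u(1)])
  \<comment> \<open>Multiplication by \<open>F\<close> replaces \<open>u\<close> by
    \<open>u'\<close> in the integrand, so the mean of \<open>F\<close> under the density
    \<open>p z\<close> is a ratio of the two transforms.\<close>
  have ip: "integrable M (p z)" and p1: "(\<integral>x. p z x \<partial>M) = 1"
    and iFp: "integrable M (\<lambda>x. F x * p z x)"
    and Fp: "(\<integral>x. F x * p z x \<partial>M) = exp ((T z - T' z) / e)" for z
  proof -
    have eq1: "p z x = exp (T z / e) * (exp (u x / e) * gibbs e (c x z))"
      and eq2: "F x * p z x = exp (T z / e) * (exp (u' x / e) * gibbs e (c x z))" for x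
      by (auto simp: p_def F_def add_divide_distrib diff_divide_distrib exp_add exp_diff)
    have i: "integrable M (\<lambda>x. exp (T z / e) * (exp (u x / e) * gibbs e (c x z)))"
      "integrable M (\<lambda>x. exp (T z / e) * (exp (u' x / e) * gibbs e (c x z)))"
      by (intro integrable_mult_right integrable_exp_gibbs u(1) u'(1))+
    show "integrable M (p z)"
      using i(1) by (simp only: eq1[abs_def])
    show "integrable M (\<lambda>x. F x * p z x)"
      using i(2) by (simp only: eq2)
    have "(\<integral>x. p z x \<partial>M) = exp (T z / e) * exp (- T z / e)"
      by (simp only: eq1 integral_mult_right_zero exp_transform[OF u(1)] T_def)
    then show "(\<integral>x. p z x \<partial>M) = 1"
      by (simp add: exp_add[symmetric])
    have "(\<integral>x. F x * p z x \<partial>M) = exp (T z / e) * exp (- T' z / e)"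
      by (simp only: eq2 integral_mult_right_zero exp_transform[OF u'(1)] T'_def)
    then show "(\<integral>x. F x * p z x \<partial>M) = exp ((T z - T' z) / e)"
      by (simp add: exp_add[symmetric] diff_divide_distrib)
  qed
  have m0: "0 \<le> m x" for x by (simp add: m_def)
  have im: "integrable M m"
    unfolding m_def
    by (intro integrable_mult_right M1.integrable_const_bound[where B = 1])
      (use e_pos in \<open>auto intro!: mult_le_one\<close>)
  have mp: "m x \<le> p y x" "m x \<le> p y' x" for x
  proof -
    have E: "exp (- 2 * K / e) \<le> exp ((u x + T z) / e)" for z
      using u(2)[of x] Tb[of z] e_pos unfolding exp_le_cancel_iff
      by (intro divide_right_mono) (auto simp: abs_le_iff)
    have "gibbs e (c x y) * gibbs e (c x y') \<le> gibbs e (c x y)"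
      "gibbs e (c x y) * gibbs e (c x y') \<le> gibbs e (c x y')"
      using e_pos by (auto intro: mult_left_le mult_left_le_one_le)
    then show "m x \<le> p y x" "m x \<le> p y' x"
      unfolding m_def p_def using E by (auto intro!: mult_mono)
  qed
  have iFm: "integrable M (\<lambda>x. F x * m x)"
  proof (rule Bochner_Integration.integrable_bound[OF iFp[of y]])
    show "(\<lambda>x. F x * m x) \<in> borel_measurable M"
      unfolding F_def m_def by measurable
    show "AE x in M. norm (F x * m x) \<le> norm (F x * p y x)"
      using mp m0 Fpos by (auto simp: abs_mult order_trans[OF m0 mp(1)] intro!: AE_I2 mult_left_mono)
  qed
  have "exp (- 4 * K / e) = exp (- 2 * K / e) * exp (- 2 * K / e)"
    by (simp add: exp_add[symmetric] add_divide_distrib[symmetric])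
  also have "\<dots> \<le> L"
    unfolding L_def m_def integral_mult_right_zero
    by (intro mult_left_mono overlap_lower_bound) simp
  finally have L: "1 - L \<le> contraction_rate" by (simp add: contraction_rate_def)
  have L1: "L \<le> 1"
    unfolding L_def p1[of y, symmetric] by (rule integral_mono[OF im ip]) (rule mp)
  have BA: "A * L \<le> B"
    unfolding B_def L_def integral_mult_right_zero[symmetric]
    by (rule integral_mono) (use im iFm AF m0 in \<open>auto intro: mult_right_mono\<close>)
  have iFpm: "integrable M (\<lambda>x. F x * (p z x - m x))" for z
    using iFp iFm by (simp add: right_diff_distrib)
  have "(\<integral>x. F x * p y x \<partial>M) - B = (\<integral>x. F x * (p y x - m x) \<partial>M)"
    unfolding B_def using iFp iFm by (simp add: right_diff_distrib)
  also have "\<dots> \<le> (\<integral>x. ((1 + d) * A) * (p y x - m x) \<partial>M)"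
    by (rule integral_mono)
      (use iFpm ip im FA mp in \<open>auto intro: mult_right_mono\<close>)
  also have "\<dots> = (1 + d) * A * (1 - L)"
    using ip im by (simp add: L_def p1)
  finally have up: "exp ((T y - T' y) / e) \<le> (1 + d) * A * (1 - L) + B" by (simp add: Fp)
  have "A * (1 - L) = (\<integral>x. A * (p y' x - m x) \<partial>M)"
    using ip im by (simp add: L_def p1)
  also have "\<dots> \<le> (\<integral>x. F x * (p y' x - m x) \<partial>M)"
    by (rule integral_mono)
      (use iFpm ip im AF mp in \<open>auto intro: mult_right_mono\<close>)
  also have "\<dots> = (\<integral>x. F x * p y' x \<partial>M) - B"
    unfolding B_def using iFp iFm by (simp add: right_diff_distrib)
  finally have low: "A * (1 - L) + B \<le> exp ((T y' - T' y') / e)" by (simp add: Fp)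
  \<comment> \<open>The bounds \<open>up\<close> and \<open>low\<close> share the term
    \<open>B\<close> and differ by \<open>(1 - L) * d * A\<close>. As the average at
    \<open>y'\<close> is at least \<open>A\<close>, this difference becomes a relative
    error.\<close>
  have "A \<le> exp ((T y' - T' y') / e)"
    using low BA by (simp add: algebra_simps)
  then have "(1 - L) * d * A \<le> contraction_rate * d * exp ((T y' - T' y') / e)"
    using L \<open>0 \<le> d\<close> Apos contraction_rate L1 by (intro mult_mono) auto
  then have "exp ((T y - T' y) / e) \<le> (1 + contraction_rate * d) * exp ((T y' - T' y') / e)"
    using up low by (simp add: algebra_simps)
  moreover have "exp ((T' y' - T y' - (T' y - T y)) / e)
      = exp ((T y - T' y) / e) / exp ((T y' - T' y') / e)"
    unfolding exp_diff[symmetric] diff_divide_distrib[symmetric] by (simp add: algebra_simps)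
  ultimately show "exp ((soft_transform e M c u' y' - soft_transform e M c u y'
      - (soft_transform e M c u' y - soft_transform e M c u y)) / e) \<le> 1 + contraction_rate * d"
    unfolding T_def T'_def by (simp add: divide_le_eq)
qed

end

section \<open>Geometric convergence of the iteration\<close>

locale sinkhorn = bounded_cost +
  fixes u :: "nat \<Rightarrow> 'a \<Rightarrow> real" and v :: "nat \<Rightarrow> 'b \<Rightarrow> real"
  assumes u_0: "admissible K M (u 0)" and v_0: "admissible K N (v 0)"
    and v_step: "\<And>n. admissible K M (u n) \<Longrightarrow> v n = soft_transform e M c (u n)"
    and u_step: "\<And>n. admissible K N (v n) \<Longrightarrow> u (Suc n) = soft_transform e N (\<lambda>y x. c x y) (v n)"
begin

text \<open>The recursions of the locale presuppose admissibility, under which the extended-valued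
  transforms are finite; this induction discharges the condition. \<open>admissible_step\<close> is
  used twice, the second time with the roles of \<open>u\<close> and \<open>v\<close>
  exchanged.\<close>

lemma iterates_admissible: "admissible K M (u n) \<and> admissible K N (v n)"
proof (induction n)
  case 0
  show ?case using u_0 v_0 by simp
next
  case (Suc n)
  interpret S: bounded_cost N M "\<lambda>y x. c x y" e K by (rule swapped)
  have "admissible K M (u (Suc n))"
    by (rule admissible_step[OF _ _ v_step u_step]) (use Suc in auto)
  moreover from this have "admissible K N (v (Suc n))"
    by (intro S.admissible_step[OF _ _ u_step v_step]) (use Suc in auto)
  ultimately show ?case by simp
qed

lemma u_admissible: "admissible K M (u n)" and v_admissible: "admissible K N (v n)"
  using iterates_admissible by auto

lemma v_eq: "v n = soft_transform e M c (u n)"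
  by (rule v_step[OF u_admissible])

lemma u_Suc: "u (Suc n) = soft_transform e N (\<lambda>y x. c x y) (v n)"
  by (rule u_step[OF v_admissible])

lemma v_bounded: "\<bar>v n y\<bar> \<le> K"
  unfolding v_eq by (rule transform_bounded[OF u_admissible])

text \<open>The index starts at 1: unlike \<open>v 0\<close>, the function \<open>u 0\<close> is not
  a transform.\<close>

lemma u_bounded: "\<bar>u (Suc n) x\<bar> \<le> K"
proof -
  interpret S: bounded_cost N M "\<lambda>y x. c x y" e K by (rule swapped)
  show ?thesis unfolding u_Suc by (rule S.transform_bounded[OF v_admissible])
qed

text \<open>The two factors alternate: each bound for \<open>u\<close> gives one for
  \<open>v\<close> by \<open>transform_contracts\<close>, and that one gives the next bound for
  \<open>u\<close>.\<close>

lemma increments_osc: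
  defines "d \<equiv> \<lambda>n. exp (4 * K / e) * contraction_rate ^ n"
  shows "osc_le e (d n) (\<lambda>x. u (Suc (Suc n)) x - u (Suc n) x)"
    and "osc_le e (contraction_rate * d n) (\<lambda>y. v (Suc (Suc n)) y - v (Suc n) y)"
proof -
  interpret S: bounded_cost N M "\<lambda>y x. c x y" e K by (rule swapped)
  have d0: "0 \<le> d n" for n using contraction_rate by (simp add: d_def)
  have step: "osc_le e (contraction_rate * d n) (\<lambda>y. v (Suc (Suc n)) y - v (Suc n) y)"
    if "osc_le e (d n) (\<lambda>x. u (Suc (Suc n)) x - u (Suc n) x)" for n
    unfolding v_eq using transform_contracts[OF u_admissible u_bounded u_admissible u_bounded that d0] .
  show *: "osc_le e (d n) (\<lambda>x. u (Suc (Suc n)) x - u (Suc n) x)"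
  proof (induction n)
    case 0
    \<comment> \<open>Four values, each of size at most \<open>K\<close>, give the initial
      constant.\<close>
    have "((u 2 x - u 1 x) - (u 2 x' - u 1 x')) / e \<le> 4 * K / e" for x x'
      using u_bounded[of 1 x] u_bounded[of 0 x] u_bounded[of 1 x'] u_bounded[of 0 x'] e_pos
      by (intro divide_right_mono) (auto simp: numeral_2_eq_2)
    then have "exp (((u 2 x - u 1 x) - (u 2 x' - u 1 x')) / e) \<le> exp (4 * K / e)" for x x'
      by (simp only: exp_le_cancel_iff)
    then show ?case by (simp add: osc_le_def d_def numeral_2_eq_2 add_increasing)
  next
    case (Suc n)
    have rd: "0 \<le> contraction_rate * d n" using d0 contraction_rate by simp
    have "osc_le e (contraction_rate * (contraction_rate * d n))
        (\<lambda>x. u (Suc (Suc (Suc n))) x - u (Suc (Suc n)) x)"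
      unfolding u_Suc[of "Suc _"]
      using S.transform_contracts[OF v_admissible v_bounded v_admissible v_bounded step[OF Suc.IH] rd] .
    \<comment> \<open>A full step gains the square of the rate; one factor is given up to keep the
      simple form of \<open>d\<close>.\<close>
    moreover have "contraction_rate * (contraction_rate * d n) \<le> d (Suc n)"
      using contraction_rate d0[of "Suc n"] mult_left_le_one_le[of "d (Suc n)" contraction_rate]
      by (simp add: d_def mult_ac)
    ultimately show ?case by (rule osc_le_mono)
  qed
  show "osc_le e (contraction_rate * d n) (\<lambda>y. v (Suc (Suc n)) y - v (Suc n) y)"
    by (rule step[OF *])
qed

text \<open>\<open>mass_one\<close> supplies the normalization that turns the oscillation of an
  increment into its sup norm.\<close>

lemma u_uniform_limit: "\<exists>ubar. uniform_limit UNIV u ubar sequentially"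
proof -
  let ?d = "\<lambda>n. exp (4 * K / e) * contraction_rate ^ n"
  have "\<bar>u (Suc (Suc n)) x - u (Suc n) x\<bar> \<le> e * ?d n" for n x
  proof (rule M1.osc_le_imp_abs_le[OF increments_osc(1)])
    show "integrable M (\<lambda>x. exp (- (u (Suc (Suc n)) x - u (Suc n) x) / e))"
      "(\<integral>x. exp (- (u (Suc (Suc n)) x - u (Suc n) x) / e) \<partial>M) = 1"
      using mass_one[OF u_admissible v_admissible v_eq u_Suc, of "Suc n"] by simp_all
  qed (use e_pos contraction_rate in auto)
  then have "\<exists>g. uniform_limit UNIV (\<lambda>n. u (Suc n)) g sequentially"
    using contraction_rate
    by (intro uniformly_convergent_of_geometric_increments
        [where C = "e * exp (4 * K / e)" and r = contraction_rate]) (auto simp: mult_ac)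
  then show ?thesis
    by (auto dest!: iffD1[OF uniform_limit_sequentially_Suc])
qed

lemma v_uniform_limit: "\<exists>vbar. uniform_limit UNIV v vbar sequentially"
proof -
  interpret S: bounded_cost N M "\<lambda>y x. c x y" e K by (rule swapped)
  let ?d = "\<lambda>n. contraction_rate * (exp (4 * K / e) * contraction_rate ^ n)"
  have "\<bar>v (Suc (Suc n)) x - v (Suc n) x\<bar> \<le> e * ?d n" for n x
  proof (rule M2.osc_le_imp_abs_le[OF increments_osc(2)])
    show "integrable N (\<lambda>x. exp (- (v (Suc (Suc n)) x - v (Suc n) x) / e))"
      "(\<integral>x. exp (- (v (Suc (Suc n)) x - v (Suc n) x) / e) \<partial>N) = 1"
      using S.mass_one[OF v_admissible u_admissible u_Suc v_eq, of "Suc n"] by simp_all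
  qed (use e_pos contraction_rate in auto)
  then have "\<exists>g. uniform_limit UNIV (\<lambda>n. v (Suc n)) g sequentially"
    using contraction_rate
    by (intro uniformly_convergent_of_geometric_increments
        [where C = "e * (contraction_rate * exp (4 * K / e))" and r = contraction_rate]) (auto simp: mult_ac)
  then show ?thesis
    by (auto dest!: iffD1[OF uniform_limit_sequentially_Suc])
qed

end

section \<open>Optimality and uniqueness for solutions of the Schroedinger system\<close>

locale schroedinger_pair = bounded_cost +
  fixes u :: "'a \<Rightarrow> real" and v :: "'b \<Rightarrow> real"
  assumes u_meas [measurable]: "u \<in> borel_measurable M" and v_meas [measurable]: "v \<in> borel_measurable N"
    and u_bound: "\<And>x. \<bar>u x\<bar> \<le> K" and v_bound: "\<And>y. \<bar>v y\<bar> \<le> K"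
    and v_fixed: "\<And>y. exp (- v y / e) = (\<integral>x. exp (u x / e) * gibbs e (c x y) \<partial>M)"
    and u_fixed: "\<And>x. exp (- u x / e) = (\<integral>y. exp (v y / e) * gibbs e (c x y) \<partial>N)"
begin

lemma schroedinger_swapped: "schroedinger_pair N M (\<lambda>y x. c x y) e K v u"
proof -
  interpret S: bounded_cost N M "\<lambda>y x. c x y" e K by (rule swapped)
  show ?thesis
    by unfold_locales (use u_bound v_bound v_fixed u_fixed in auto)
qed

text \<open>The density of the entropic optimal plan with respect to the product measure.\<close>

definition plan :: "'a \<times> 'b \<Rightarrow> real" where
  "plan z = exp ((u (fst z) + v (snd z)) / e) * gibbs e (c (fst z) (snd z))"

lemma plan_nonneg [simp]: "0 \<le> plan z"
  by (simp add: plan_def)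

lemma plan_measurable [measurable]: "plan \<in> borel_measurable (M \<Otimes>\<^sub>M N)"
  unfolding plan_def[abs_def] by measurable

lemma c_snd_measurable [measurable]: "(\<lambda>y. c x y) \<in> borel_measurable N"
  by (rule c_measurable) auto

lemma plan_marginal_fst: "(\<integral>\<^sup>+y. ennreal (plan (x, y)) \<partial>N) = 1"
proof -
  \<comment> \<open>A non-integrable function has Bochner integral 0, whereas this integral equals
    an exponential.\<close>
  have i: "integrable N (\<lambda>y. exp (v y / e) * gibbs e (c x y))"
    using u_fixed[of x] by (metis exp_not_eq_zero not_integrable_integral_eq)
  have "(\<integral>\<^sup>+y. ennreal (plan (x, y)) \<partial>N)
      = (\<integral>\<^sup>+y. ennreal (exp (u x / e)) * ennreal (exp (v y / e) * gibbs e (c x y)) \<partial>N)"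
    by (simp add: plan_def add_divide_distrib exp_add ennreal_mult[symmetric] mult_ac)
  also have "\<dots> = 1"
    using i by (simp add: nn_integral_cmult nn_integral_eq_integral u_fixed[symmetric]
        ennreal_mult[symmetric] exp_add[symmetric])
  finally show ?thesis .
qed

lemma nn_integral_plan_fst:
  assumes [measurable]: "f \<in> borel_measurable M"
  shows "(\<integral>\<^sup>+z. ennreal (plan z) * f (fst z) \<partial>(M \<Otimes>\<^sub>M N)) = (\<integral>\<^sup>+x. f x \<partial>M)"
proof -
  have "(\<integral>\<^sup>+z. ennreal (plan z) * f (fst z) \<partial>(M \<Otimes>\<^sub>M N))
      = (\<integral>\<^sup>+x. (\<integral>\<^sup>+y. ennreal (plan (x, y)) * f x \<partial>N) \<partial>M)"
    by (subst M2.nn_integral_fst[symmetric]) auto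
  also have "\<dots> = (\<integral>\<^sup>+x. f x \<partial>M)"
    by (simp add: nn_integral_multc plan_marginal_fst)
  finally show ?thesis .
qed

lemma plan_has_integral: "integrable (M \<Otimes>\<^sub>M N) plan" "(\<integral>z. plan z \<partial>(M \<Otimes>\<^sub>M N)) = 1"
proof -
  have nn: "(\<integral>\<^sup>+z. ennreal (plan z) \<partial>(M \<Otimes>\<^sub>M N)) = 1"
    using nn_integral_plan_fst[of "\<lambda>_. 1"] by simp
  show "integrable (M \<Otimes>\<^sub>M N) plan"
    by (rule integrableI_bounded) (use nn in auto)
  show "(\<integral>z. plan z \<partial>(M \<Otimes>\<^sub>M N)) = 1"
    using nn by (subst integral_eq_nn_integral) auto
qed

lemma integral_plan_fst:
  fixes f :: "'a \<Rightarrow> real"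
  assumes f: "integrable M f"
  shows "integrable (M \<Otimes>\<^sub>M N) (\<lambda>z. plan z * f (fst z))"
    and "(\<integral>z. plan z * f (fst z) \<partial>(M \<Otimes>\<^sub>M N)) = (\<integral>x. f x \<partial>M)"
proof -
  have [measurable]: "f \<in> borel_measurable M" using f by simp
  have "(\<integral>\<^sup>+z. ennreal (norm (plan z * f (fst z))) \<partial>(M \<Otimes>\<^sub>M N)) = (\<integral>\<^sup>+x. ennreal \<bar>f x\<bar> \<partial>M)"
    using nn_integral_plan_fst[of "\<lambda>x. ennreal \<bar>f x\<bar>"] by (simp add: abs_mult ennreal_mult)
  also have "\<dots> < \<infinity>" using f by (simp add: integrable_iff_bounded)
  finally show i: "integrable (M \<Otimes>\<^sub>M N) (\<lambda>z. plan z * f (fst z))"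
    by (intro integrableI_bounded) auto
  have one: "(\<integral>y. plan (x, y) \<partial>N) = 1" for x
    using plan_marginal_fst[of x] by (subst integral_eq_nn_integral) auto
  have "(\<integral>z. plan z * f (fst z) \<partial>(M \<Otimes>\<^sub>M N)) = (\<integral>x. (\<integral>y. plan (x, y) * f x \<partial>N) \<partial>M)"
    using integral_fst'[OF i] by simp
  then show "(\<integral>z. plan z * f (fst z) \<partial>(M \<Otimes>\<^sub>M N)) = (\<integral>x. f x \<partial>M)"
    by (simp add: one)
qed

text \<open>The plan of the swapped pair is the same density with its coordinates exchanged, so the
  second marginal reduces to the first.\<close>

lemma integral_plan_snd:
  fixes g :: "'b \<Rightarrow> real"
  assumes g: "integrable N g"
  shows "integrable (M \<Otimes>\<^sub>M N) (\<lambda>z. plan z * g (snd z))"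
    and "(\<integral>z. plan z * g (snd z) \<partial>(M \<Otimes>\<^sub>M N)) = (\<integral>y. g y \<partial>N)"
proof -
  interpret S: schroedinger_pair N M "\<lambda>y x. c x y" e K v u by (rule schroedinger_swapped)
  have eq: "(\<lambda>(x, y). S.plan (y, x) * g (fst (y, x))) = (\<lambda>z. plan z * g (snd z))"
    by (auto simp: plan_def S.plan_def add.commute)
  show "integrable (M \<Otimes>\<^sub>M N) (\<lambda>z. plan z * g (snd z))"
    using S.integrable_product_swap[OF S.integral_plan_fst(1)[OF g]] unfolding eq .
  show "(\<integral>z. plan z * g (snd z) \<partial>(M \<Otimes>\<^sub>M N)) = (\<integral>y. g y \<partial>N)"
    using S.integral_product_swap[OF borel_measurable_integrable[OF S.integral_plan_fst(1)[OF g]]]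
    unfolding eq S.integral_plan_fst(2)[OF g] .
qed

lemma u_integrable: "integrable M u" and v_integrable: "integrable N v"
  using u_bound v_bound
  by (auto intro!: M1.integrable_const_bound[where B = K] M2.integrable_const_bound[where B = K])

definition deviation :: "('a \<Rightarrow> real) \<Rightarrow> ('b \<Rightarrow> real) \<Rightarrow> 'a \<times> 'b \<Rightarrow> real" where
  "deviation u' v' z = (u' (fst z) - u (fst z)) + (v' (snd z) - v (snd z))"

text \<open>Taking \<open>plan\<close> as reference density, the competitor enters the exponential
  only through its difference from \<open>(u, v)\<close>.\<close>

lemma dual_functional_eq:
  "dual_functional (case_prod c) e M N u' v' = ereal ((\<integral>x. u' x \<partial>M) + (\<integral>y. v' y \<partial>N))
    - ereal e * enn2ereal (\<integral>\<^sup>+z. ennreal (plan z * exp (deviation u' v' z / e)) \<partial>(M \<Otimes>\<^sub>M N)) + ereal e"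
proof -
  have "exp_ereal ((ereal (u' x + v' y) - enn2ereal (c x y)) / ereal e)
      = ennreal (plan (x, y) * exp (deviation u' v' (x, y) / e))" for x y
    unfolding exp_ereal_gibbs[OF e_pos] plan_def deviation_def
    by (rule arg_cong[where f = ennreal])
      (simp add: exp_add[symmetric] add_divide_distrib diff_divide_distrib)
  then show ?thesis
    unfolding dual_functional_def by (simp add: case_prod_unfold)
qed

text \<open>By the marginals of \<open>plan\<close>, the linear terms are an integral of
  \<open>deviation\<close> against it, and its mass 1 absorbs the constant \<open>e\<close>. What
  remains is the integrated gap in \<open>1 + t <= exp t\<close>. The first alternative is the case
  of an infinite exponential integral.\<close>

lemma dual_value:
  assumes u': "integrable M u'" and v': "integrable N v'"
  defines "gap \<equiv> \<lambda>z. plan z * (exp (deviation u' v' z / e) - (1 + deviation u' v' z / e))"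
  shows "dual_functional (case_prod c) e M N u' v' = -\<infinity> \<or>
    integrable (M \<Otimes>\<^sub>M N) gap \<and>
    dual_functional (case_prod c) e M N u' v' =
      ereal ((\<integral>x. u x \<partial>M) + (\<integral>y. v y \<partial>N) - e * (\<integral>z. gap z \<partial>(M \<Otimes>\<^sub>M N)))"
proof -
  let ?P = "M \<Otimes>\<^sub>M N" and ?E = "\<lambda>z. plan z * exp (deviation u' v' z / e)"
  have [measurable]: "u' \<in> borel_measurable M" "v' \<in> borel_measurable N" using u' v' by auto
  have [measurable]: "deviation u' v' \<in> borel_measurable ?P"
    unfolding deviation_def[abs_def] by measurable
  show ?thesis
  proof (cases "(\<integral>\<^sup>+z. ennreal (?E z) \<partial>?P) = \<infinity>")
    case True
    then show ?thesis using e_pos by (simp add: dual_functional_eq)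
  next
    case False
    then have iE: "integrable ?P ?E"
      by (intro integrableI_bounded) (auto simp: abs_mult less_top)
    have lin: "(\<lambda>z. plan z * (1 + deviation u' v' z / e)) =
        (\<lambda>z. plan z + (plan z * (u' (fst z) - u (fst z)) + plan z * (v' (snd z) - v (snd z))) / e)"
      using e_pos by (auto simp: deviation_def field_simps)
    have iu: "integrable M (\<lambda>x. u' x - u x)" and iv: "integrable N (\<lambda>y. v' y - v y)"
      using u' v' u_integrable v_integrable by auto
    have il: "integrable ?P (\<lambda>z. plan z * (1 + deviation u' v' z / e))"
      unfolding lin using integral_plan_fst(1)[OF iu] integral_plan_snd(1)[OF iv] plan_has_integral(1)
      by simp
    have vl: "(\<integral>z. plan z * (1 + deviation u' v' z / e) \<partial>?P)
        = 1 + ((\<integral>x. u' x - u x \<partial>M) + (\<integral>y. v' y - v y \<partial>N)) / e"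
      unfolding lin
      using integral_plan_fst[OF iu] integral_plan_snd[OF iv] plan_has_integral by simp
    have gap: "gap = (\<lambda>z. ?E z - plan z * (1 + deviation u' v' z / e))"
      unfolding gap_def by (simp add: right_diff_distrib)
    have ig: "integrable ?P gap" unfolding gap using iE il by simp
    have "(\<integral>z. ?E z \<partial>?P) = (\<integral>z. gap z \<partial>?P)
        + (1 + ((\<integral>x. u' x - u x \<partial>M) + (\<integral>y. v' y - v y \<partial>N)) / e)"
      unfolding gap vl[symmetric] using iE il by simp
    moreover have "(\<integral>\<^sup>+z. ennreal (?E z) \<partial>?P) = ennreal (\<integral>z. ?E z \<partial>?P)"
      by (rule nn_integral_eq_integral[OF iE]) simp
    moreover have "0 \<le> (\<integral>z. ?E z \<partial>?P)" by simp
    ultimately show ?thesis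
      using ig e_pos u' v' u_integrable v_integrable
      by (simp add: dual_functional_eq enn2ereal_ennreal field_simps)
  qed
qed

lemma gap_nonneg: "0 \<le> plan z * (exp t - (1 + t))"
  by (simp add: exp_ge_add_one_self)

lemma dual_le:
  assumes "integrable M u'" "integrable N v'"
  shows "dual_functional (case_prod c) e M N u' v' \<le> ereal ((\<integral>x. u x \<partial>M) + (\<integral>y. v y \<partial>N))"
  using dual_value[OF assms] e_pos
    Bochner_Integration.integral_nonneg[of "M \<Otimes>\<^sub>M N", OF gap_nonneg[of _ "deviation u' v' _ / e"]]
  by auto

text \<open>Every section of the cost has a finite integral, so the kernel vanishes only on a null
  set. Hence a property valid almost everywhere for the plan holds almost everywhere for the product
  measure.\<close>

lemma AE_plan_pos: "AE z in M \<Otimes>\<^sub>M N. 0 < plan z"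
proof (rule AE_pair_measure)
  show "AE x in M. AE y in N. 0 < plan (x, y)"
  proof (rule AE_I2)
    fix x
    have "(\<integral>\<^sup>+y. c x y \<partial>N) \<noteq> \<infinity>"
      using cost_snd[of x] by (auto simp: top_unique)
    then have "AE y in N. c x y \<noteq> \<infinity>" by (intro nn_integral_PInf_AE) auto
    then show "AE y in N. 0 < plan (x, y)"
      by eventually_elim (simp add: plan_def gibbs_pos)
  qed
qed measurable

text \<open>Equality forces the gap to vanish almost everywhere, and \<open>exp t = 1 + t\<close>
  holds only at \<open>t = 0\<close>.\<close>

lemma dual_eq_iff_deviation:
  assumes "integrable M u'" "integrable N v'"
  shows "dual_functional (case_prod c) e M N u' v' = ereal ((\<integral>x. u x \<partial>M) + (\<integral>y. v y \<partial>N))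
    \<longleftrightarrow> (AE z in M \<Otimes>\<^sub>M N. deviation u' v' z = 0)"
proof
  let ?gap = "\<lambda>z. plan z * (exp (deviation u' v' z / e) - (1 + deviation u' v' z / e))"
  assume "dual_functional (case_prod c) e M N u' v' = ereal ((\<integral>x. u x \<partial>M) + (\<integral>y. v y \<partial>N))"
  with dual_value[OF assms] e_pos
  have i: "integrable (M \<Otimes>\<^sub>M N) ?gap" and "(\<integral>z. ?gap z \<partial>(M \<Otimes>\<^sub>M N)) = 0"
    by auto
  then have "AE z in M \<Otimes>\<^sub>M N. ?gap z = 0"
    using integral_nonneg_eq_0_iff_AE[OF i] gap_nonneg by auto
  with AE_plan_pos show "AE z in M \<Otimes>\<^sub>M N. deviation u' v' z = 0"
  proof eventually_elim
    case (elim z)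
    then have "exp (deviation u' v' z / e) = 1 + deviation u' v' z / e" by simp
    then have "ln (exp (deviation u' v' z / e)) = exp (deviation u' v' z / e) - 1"
      unfolding ln_exp by linarith
    then have "exp (deviation u' v' z / e) = 1" by (rule ln_eq_minus_one[rotated]) simp
    then show ?case using e_pos by simp
  qed
next
  assume dev: "AE z in M \<Otimes>\<^sub>M N. deviation u' v' z = 0"
  have [measurable]: "u' \<in> borel_measurable M" "v' \<in> borel_measurable N" using assms by auto
  have [measurable]: "deviation u' v' \<in> borel_measurable (M \<Otimes>\<^sub>M N)"
    unfolding deviation_def[abs_def] by measurable
  have "(\<integral>\<^sup>+z. ennreal (plan z * exp (deviation u' v' z / e)) \<partial>(M \<Otimes>\<^sub>M N))
      = (\<integral>\<^sup>+z. ennreal (plan z) \<partial>(M \<Otimes>\<^sub>M N))"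
    by (rule nn_integral_cong_AE) (use dev in \<open>auto elim: eventually_mono\<close>)
  also have "\<dots> = 1" using nn_integral_plan_fst[of "\<lambda>_. 1"] by simp
  \<comment> \<open>Excludes the infinite alternative of \<open>dual_value\<close>.\<close>
  finally have fin: "dual_functional (case_prod c) e M N u' v' \<noteq> - \<infinity>"
    by (simp add: dual_functional_eq one_ennreal.rep_eq)
  have "(\<integral>z. plan z * (exp (deviation u' v' z / e) - (1 + deviation u' v' z / e)) \<partial>(M \<Otimes>\<^sub>M N)) = 0"
    by (rule integral_eq_zero_AE) (use dev in \<open>auto elim: eventually_mono\<close>)
  with dual_value[OF assms] fin
  show "dual_functional (case_prod c) e M N u' v' = ereal ((\<integral>x. u x \<partial>M) + (\<integral>y. v y \<partial>N))"
    by simp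
qed

text \<open>Separation of variables: freezing one typical \<open>x0\<close> shows that
  \<open>v' - v\<close> is almost everywhere constant, and then so is \<open>u' - u\<close> with the
  opposite constant.\<close>

lemma deviation_zero_iff:
  assumes [measurable]: "u' \<in> borel_measurable M" "v' \<in> borel_measurable N"
  shows "(AE z in M \<Otimes>\<^sub>M N. deviation u' v' z = 0)
    \<longleftrightarrow> (\<exists>a. (AE x in M. u' x = u x + a) \<and> (AE y in N. v' y = v y - a))"
proof
  assume "AE z in M \<Otimes>\<^sub>M N. deviation u' v' z = 0"
  then have ae: "AE x in M. AE y in N. deviation u' v' (x, y) = 0" by (rule AE_pair)
  obtain x0 where x0: "AE y in N. deviation u' v' (x0, y) = 0"
  proof (rule ccontr)
    assume "\<not> thesis"
    with that have "\<not> (AE y in N. deviation u' v' (x, y) = 0)" for x by blast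
    with ae show False using M1.AE_False by simp
  qed
  define a where "a = u' x0 - u x0"
  have v': "AE y in N. v' y = v y - a"
    using x0 by eventually_elim (simp add: deviation_def a_def algebra_simps)
  have "AE x in M. u' x = u x + a"
    using ae
  proof eventually_elim
    case (elim x)
    \<comment> \<open>The statement does not depend on \<open>y\<close>, and \<open>N\<close> is a
      probability measure, so it holds outright.\<close>
    with v' have "AE y in N. u' x = u x + a"
      by eventually_elim (simp add: deviation_def)
    then show ?case by simp
  qed
  with v' show "\<exists>a. (AE x in M. u' x = u x + a) \<and> (AE y in N. v' y = v y - a)" by blast
next
  assume "\<exists>a. (AE x in M. u' x = u x + a) \<and> (AE y in N. v' y = v y - a)"
  then obtain a where u': "AE x in M. u' x = u x + a" and v': "AE y in N. v' y = v y - a" by blast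
  show "AE z in M \<Otimes>\<^sub>M N. deviation u' v' z = 0"
  proof (rule AE_pair_measure)
    show "{z \<in> space (M \<Otimes>\<^sub>M N). deviation u' v' z = 0} \<in> sets (M \<Otimes>\<^sub>M N)"
      unfolding deviation_def by measurable
    show "AE x in M. AE y in N. deviation u' v' (x, y) = 0"
      using u'
    proof eventually_elim
      case (elim x)
      show ?case using v' by eventually_elim (simp add: deviation_def elim)
    qed
  qed
qed

text \<open>The upper bound of \<open>dual_le\<close> is attained at \<open>(u, v)\<close>, so the
  maximizers are exactly the pairs with equality there.\<close>

lemma dual_maximizer_iff:
  assumes "integrable M u'" "integrable N v'"
  shows "dual_maximizer (case_prod c) e M N u' v'
    \<longleftrightarrow> (\<exists>a. (AE x in M. u' x = u x + a) \<and> (AE y in N. v' y = v y - a))"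
proof -
  let ?D = "dual_functional (case_prod c) e M N" and ?S = "ereal ((\<integral>x. u x \<partial>M) + (\<integral>y. v y \<partial>N))"
  have "?D u v = ?S"
    using dual_eq_iff_deviation[OF u_integrable v_integrable] by (simp add: deviation_def)
  then have "dual_maximizer (case_prod c) e M N u' v' \<longleftrightarrow> ?D u' v' = ?S"
    using dual_le u_integrable v_integrable assms unfolding dual_maximizer_def is_arg_max_def
    by (auto simp: not_less intro: antisym) (metis antisym)
  then show ?thesis
    using dual_eq_iff_deviation[OF assms] deviation_zero_iff assms by auto
qed

end

section \<open>The limit solves the Schroedinger system\<close>

context sinkhorn
begin

text \<open>Dominated convergence with the constant \<open>exp (K / e)\<close>. In the first
  equation the shifted index avoids \<open>u 0\<close>, which need not obey the pointwise
  bound.\<close>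

lemma limit_fixed_point:
  assumes u: "\<And>x. (\<lambda>n. u n x) \<longlonglongrightarrow> ubar x" and v: "\<And>y. (\<lambda>n. v n y) \<longlonglongrightarrow> vbar y"
  shows "schroedinger_pair M N c e K ubar vbar"
proof -
  interpret S: bounded_cost N M "\<lambda>y x. c x y" e K by (rule swapped)
  have [measurable]: "u n \<in> borel_measurable M" "v n \<in> borel_measurable N" for n
    using u_admissible v_admissible by (auto simp: admissible_def)
  have um [measurable]: "ubar \<in> borel_measurable M" by (rule borel_measurable_LIMSEQ_real[OF u]) auto
  have vm [measurable]: "vbar \<in> borel_measurable N" by (rule borel_measurable_LIMSEQ_real[OF v]) auto
  have u1: "(\<lambda>n. u (Suc n) x) \<longlonglongrightarrow> ubar x" for x using u by (rule LIMSEQ_Suc)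
  have v1: "(\<lambda>n. v (Suc n) x) \<longlonglongrightarrow> vbar x" for x using v by (rule LIMSEQ_Suc)
  have ub: "\<bar>ubar x\<bar> \<le> K" for x
    by (rule LIMSEQ_le_const2[OF tendsto_rabs[OF u1]]) (use u_bounded in auto)
  have vb: "\<bar>vbar y\<bar> \<le> K" for y
    by (rule LIMSEQ_le_const2[OF tendsto_rabs[OF v]]) (use v_bounded in auto)
  have bound: "exp (t / e) * gibbs e s \<le> exp (K / e)" if "\<bar>t\<bar> \<le> K" for t s
  proof -
    have "exp (t / e) * gibbs e s \<le> exp (K / e) * 1"
      using e_pos that by (intro mult_mono) (auto simp: divide_right_mono)
    then show ?thesis by simp
  qed
  have "exp (- vbar y / e) = (\<integral>x. exp (ubar x / e) * gibbs e (c x y) \<partial>M)" for y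
  proof (rule LIMSEQ_unique)
    show "(\<lambda>n. exp (- v (Suc n) y / e)) \<longlonglongrightarrow> exp (- vbar y / e)"
      using e_pos by (intro tendsto_intros v1) simp
    show "(\<lambda>n. exp (- v (Suc n) y / e)) \<longlonglongrightarrow> (\<integral>x. exp (ubar x / e) * gibbs e (c x y) \<partial>M)"
      unfolding v_eq exp_transform[OF u_admissible]
      by (rule integral_dominated_convergence[where w = "\<lambda>_. exp (K / e)"])
        (use e_pos in \<open>auto intro!: AE_I2 tendsto_intros u1 bound u_bounded\<close>)
  qed
  moreover have "exp (- ubar x / e) = (\<integral>y. exp (vbar y / e) * gibbs e (c x y) \<partial>N)" for x
  proof (rule LIMSEQ_unique)
    show "(\<lambda>n. exp (- u (Suc n) x / e)) \<longlonglongrightarrow> exp (- ubar x / e)"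
      using e_pos by (intro tendsto_intros u1) simp
    show "(\<lambda>n. exp (- u (Suc n) x / e)) \<longlonglongrightarrow> (\<integral>y. exp (vbar y / e) * gibbs e (c x y) \<partial>N)"
      unfolding u_Suc S.exp_transform[OF v_admissible]
      by (rule integral_dominated_convergence[where w = "\<lambda>_. exp (K / e)"])
        (use e_pos in \<open>auto intro!: AE_I2 tendsto_intros v bound v_bounded\<close>)
  qed
  ultimately show ?thesis
    by unfold_locales (use um vm ub vb in auto)
qed

end

section \<open>Transfer to extended-valued transforms on Polish spaces\<close>

theorem theorem3p4:
  fixes \<mu> :: "'a::polish_space measure" and \<nu> :: "'b::polish_space measure"
    and c :: "'a \<times> 'b \<Rightarrow> ennreal" and K \<epsilon> :: real
    and u :: "nat \<Rightarrow> 'a \<Rightarrow> real" and v :: "nat \<Rightarrow> 'b \<Rightarrow> real"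
  assumes "borel_probability \<mu>" and "borel_probability \<nu>"
    and "lower_semicontinuous c"
    and "(SUP y. \<integral>\<^sup>+x. c (x, y) \<partial>\<mu>) \<le> ennreal K"
    and "(SUP x. \<integral>\<^sup>+y. c (x, y) \<partial>\<nu>) \<le> ennreal K"
    and "\<epsilon> > 0"
    and "integrable \<mu> (u 0)" and "integrable \<nu> (v 0)"
    and "dual_functional c \<epsilon> \<mu> \<nu> (u 0) (v 0) \<ge> 0"
    and "AE x in \<mu>. u 0 x \<le> K" and "AE y in \<nu>. v 0 y \<le> K"
    and "(\<integral>x. u 0 x \<partial>\<mu>) \<ge> 0" and "(\<integral>y. v 0 y \<partial>\<nu>) \<ge> 0"
    and "\<And>y. ereal (v 0 y) = transform_fst c \<epsilon> \<mu> (u 0) y"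
    and "\<And>n x. u (Suc n) x = real_of_ereal (transform_snd c \<epsilon> \<nu> (v n) x)"
    and "\<And>n y. v (Suc n) y = real_of_ereal (transform_fst c \<epsilon> \<mu> (u (Suc n)) y)"
  shows "(\<forall>n x. \<bar>transform_snd c \<epsilon> \<nu> (v n) x\<bar> \<noteq> \<infinity>)
    \<and> (\<forall>n y. \<bar>transform_fst c \<epsilon> \<mu> (u (Suc n)) y\<bar> \<noteq> \<infinity>)
    \<and> (\<exists>ubar vbar.
          dual_maximizer c \<epsilon> \<mu> \<nu> ubar vbar
        \<and> (\<forall>S. compact S \<longrightarrow> uniform_limit S u ubar sequentially)
        \<and> (\<forall>T. compact T \<longrightarrow> uniform_limit T v vbar sequentially)
        \<and> (\<forall>u' v'. integrable \<mu> u' \<and> integrable \<nu> v' \<longrightarrow>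
              (dual_maximizer c \<epsilon> \<mu> \<nu> u' v' \<longleftrightarrow>
               (\<exists>a. (AE x in \<mu>. u' x = ubar x + a) \<and> (AE y in \<nu>. v' y = vbar y - a)))))"
proof -
  \<comment> \<open>The curried cost lets both transforms be instances of one operator.\<close>
  define C where "C x y = c (x, y)" for x y
  have c_eq: "c = case_prod C" by (auto simp: C_def)
  have sets [measurable_cong, simp]: "sets \<mu> = sets borel" "sets \<nu> = sets borel"
    using assms(1,2) by (auto simp: borel_probability_def)
  interpret M: prob_space \<mu> using assms(1) by (simp add: borel_probability_def)
  interpret N: prob_space \<nu> using assms(2) by (simp add: borel_probability_def)
  interpret pair_prob_space \<mu> \<nu> ..
  \<comment> \<open>Nonnegativity of \<open>K\<close> is not assumed; it follows because the mean of
    \<open>u 0\<close> lies between 0 and \<open>K\<close>.\<close>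
  have "0 \<le> (\<integral>x. u 0 x \<partial>\<mu>)" by (rule assms(12))
  also have "\<dots> \<le> (\<integral>x. K \<partial>\<mu>)"
    by (rule integral_mono_AE[OF assms(7) _ assms(10)]) simp
  finally have K: "0 \<le> K" by (simp add: M.prob_space)
  have "c \<in> borel_measurable borel"
    using assms(3) by (intro borel_measurableI_greater) (simp add: lower_semicontinuous_def greaterThan_def vimage_def)
  \<comment> \<open>Polish spaces are second countable, so the Borel sets of the product are
    generated by rectangles.\<close>
  also have "borel_measurable (borel :: ('a \<times> 'b) measure) = borel_measurable (\<mu> \<Otimes>\<^sub>M \<nu>)"
    by (rule measurable_cong_sets) (simp_all add: borel_prod[symmetric] cong: sets_pair_measure_cong)
  finally have c_meas: "c \<in> borel_measurable (\<mu> \<Otimes>\<^sub>M \<nu>)" .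
  interpret B: bounded_cost \<mu> \<nu> C \<epsilon> K
  proof unfold_locales
    show "space \<mu> = UNIV" "space \<nu> = UNIV"
      using sets_eq_imp_space_eq[OF sets(1)] sets_eq_imp_space_eq[OF sets(2)] by simp_all
    show "case_prod C \<in> borel_measurable (\<mu> \<Otimes>\<^sub>M \<nu>)" using c_meas by (simp add: c_eq)
    show "(\<integral>\<^sup>+x. C x y \<partial>\<mu>) \<le> ennreal K" for y
      using assms(4) unfolding C_def SUP_le_iff by blast
    show "(\<integral>\<^sup>+y. C x y \<partial>\<nu>) \<le> ennreal K" for x
      using assms(5) unfolding C_def SUP_le_iff by blast
  qed (use assms(6) K in auto)
  interpret S: bounded_cost \<nu> \<mu> "\<lambda>y x. C x y" \<epsilon> K by (rule B.swapped)
  have fst_eq: "transform_fst c \<epsilon> \<mu> f y = ereal (soft_transform \<epsilon> \<mu> C f y)"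
    if "admissible K \<mu> f" for f y
    using B.transform_fst_eq[OF that] by (simp add: c_eq)
  have snd_eq: "transform_snd c \<epsilon> \<nu> g x = ereal (soft_transform \<epsilon> \<nu> (\<lambda>y x. C x y) g x)"
    if "admissible K \<nu> g" for g x
    using S.transform_fst_eq[OF that, of x] by (simp add: C_def transform_fst_def transform_snd_def)
  interpret I: sinkhorn \<mu> \<nu> C \<epsilon> K u v
  proof unfold_locales
    show "admissible K \<mu> (u 0)" "admissible K \<nu> (v 0)"
      using assms by (auto simp: admissible_def)
    \<comment> \<open>Index 0 is the hypothesis on \<open>v 0\<close>; for later indices finiteness
      of the transform makes \<open>real_of_ereal\<close> exact.\<close>
    show "v n = soft_transform \<epsilon> \<mu> C (u n)" if "admissible K \<mu> (u n)" for n
      using fst_eq[OF that] assms(14,16) by (cases n) auto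
    show "u (Suc n) = soft_transform \<epsilon> \<nu> (\<lambda>y x. C x y) (v n)" if "admissible K \<nu> (v n)" for n
      using snd_eq[OF that] assms(15) by auto
  qed
  obtain ubar vbar where u_lim: "uniform_limit UNIV u ubar sequentially"
    and v_lim: "uniform_limit UNIV v vbar sequentially"
    using I.u_uniform_limit I.v_uniform_limit by blast
  interpret P: schroedinger_pair \<mu> \<nu> C \<epsilon> K ubar vbar
    by (rule I.limit_fixed_point) (auto intro: tendsto_uniform_limitI u_lim v_lim)
  have max: "dual_maximizer c \<epsilon> \<mu> \<nu> u' v' \<longleftrightarrow>
      (\<exists>a. (AE x in \<mu>. u' x = ubar x + a) \<and> (AE y in \<nu>. v' y = vbar y - a))"
    if "integrable \<mu> u'" "integrable \<nu> v'" for u' v'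
    unfolding c_eq by (rule P.dual_maximizer_iff[OF that])
  have "dual_maximizer c \<epsilon> \<mu> \<nu> ubar vbar"
    unfolding max[OF P.u_integrable P.v_integrable] by (rule exI[of _ 0]) simp
  moreover have "uniform_limit S u ubar sequentially" "uniform_limit T v vbar sequentially" for S T
    using uniform_limit_on_subset[OF u_lim subset_UNIV] uniform_limit_on_subset[OF v_lim subset_UNIV]
    by auto
  moreover have "\<bar>transform_snd c \<epsilon> \<nu> (v n) x\<bar> \<noteq> \<infinity>" "\<bar>transform_fst c \<epsilon> \<mu> (u n) y\<bar> \<noteq> \<infinity>" for n x y
    by (simp_all add: snd_eq[OF I.v_admissible] fst_eq[OF I.u_admissible])
  ultimately show ?thesis
    using max by (intro conjI exI[of _ ubar] exI[of _ vbar] allI impI) simp_all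
qed

end
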